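(* Let $H$ be a graph with $v$ vertices which is bicycle-free at radius $r$, and assume $r \geq 10 \ln v$. Then $\mathrm{exc}(H) \leq \frac{\ln(ev)}{r} v$.
   Context: The excess of a multigraph $H=(V,E)$ is $\mathrm{exc}(H) = |E| - |V|$. A connected multigraph with excess $-1$ or $0$ is called bicycle-free. A multigraph is bicycle-free at radius $r$ if the distance-$r$ neighborhood of every vertex is bicycle-free. *)

theory Defs
  imports Complex_Main "HOL-Library.Uprod" "HOL-Library.Extended_Nat"
begin

text \<open>Loops (edges with ends \<open>Upair u u\<close>) and parallel edges are allowed;
  a loop counts as one edge.\<close>

record ('v, 'e) multigraph =
  verts :: "'v set"
  edges :: "'e set"
  ends :: "'e \<Rightarrow> 'v uprod"

definition finite_multigraph :: "('v, 'e) multigraph \<Rightarrow> bool" where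
  "finite_multigraph G \<longleftrightarrow>
     finite (verts G) \<and> finite (edges G) \<and> (\<forall>e\<in>edges G. set_uprod (ends G e) \<subseteq> verts G)"

definition adj :: "('v, 'e) multigraph \<Rightarrow> 'v rel" where
  "adj G = {(u, w). \<exists>e\<in>edges G. ends G e = Upair u w}"

definition connected_multigraph :: "('v, 'e) multigraph \<Rightarrow> bool" where
  "connected_multigraph G \<longleftrightarrow>
     verts G \<noteq> {} \<and> (\<forall>u\<in>verts G. \<forall>w\<in>verts G. (u, w) \<in> (adj G)\<^sup>*)"

text \<open>Length of a shortest walk; \<open>\<infinity>\<close> (the infimum of the empty set) if there is none.\<close>

definition graph_dist :: "('v, 'e) multigraph \<Rightarrow> 'v \<Rightarrow> 'v \<Rightarrow> enat" where
  "graph_dist G u w = (INF n\<in>{n. (u, w) \<in> adj G ^^ n}. enat n)"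

definition induced_subgraph :: "('v, 'e) multigraph \<Rightarrow> 'v set \<Rightarrow> ('v, 'e) multigraph" where
  "induced_subgraph G S =
     \<lparr>verts = S, edges = {e \<in> edges G. set_uprod (ends G e) \<subseteq> S}, ends = ends G\<rparr>"

definition neighborhood :: "('v, 'e) multigraph \<Rightarrow> nat \<Rightarrow> 'v \<Rightarrow> ('v, 'e) multigraph" where
  "neighborhood G r u = induced_subgraph G {w \<in> verts G. graph_dist G u w \<le> enat r}"

definition exc :: "('v, 'e) multigraph \<Rightarrow> int" where
  "exc G = int (card (edges G)) - int (card (verts G))"

definition bicycle_free :: "('v, 'e) multigraph \<Rightarrow> bool" where
  "bicycle_free G \<longleftrightarrow> connected_multigraph G \<and> (exc G = -1 \<or> exc G = 0)"

definition bicycle_free_at_radius :: "nat \<Rightarrow> ('v, 'e) multigraph \<Rightarrow> bool" where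
  "bicycle_free_at_radius r G \<longleftrightarrow> (\<forall>u\<in>verts G. bicycle_free (neighborhood G r u))"

end

theory Submission
  imports Defs
begin

text \<open>
  Deleting vertices of degree at most one does not decrease the excess, so one may pass to an induced
  subgraph with \<open>n\<close> vertices, excess \<open>x\<close> and minimum degree at least two. There the non-backtracking
  random walk on darts (directed edges) has the uniform stationary distribution, so by concavity of
  the logarithm the number of non-backtracking walks of length \<open>r\<close> that start with a dart \<open>d\<close> is, in
  geometric mean over \<open>d\<close>, at least \<open>exp ((r - 1) \<cdot> M)\<close>, where \<open>M\<close> is the mean of
  \<open>ln (deg (head d) - 1)\<close>. Since \<open>m ln (m - 1) \<ge> 2 (m - 2)\<close>, one has \<open>M \<ge> 2 x / (n + x)\<close>. Conversely,
  these walks stay in a ball of radius \<open>r\<close>, which is a tree plus at most one edge, and in such a graph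
  a non-backtracking walk of given length and starting point is determined by its end and the first
  direction, if any, in which it uses the extra edge; so there are at most \<open>3 v\<close> of them. Comparing
  the two bounds leaves enough room for the stated constant.
\<close>

section \<open>Walks along darts\<close>

locale dart_graph =
  fixes tail :: "'d \<Rightarrow> 'v" and flip :: "'d \<Rightarrow> 'd"
  assumes flip_flip [simp]: "flip (flip d) = d"
begin

abbreviation head :: "'d \<Rightarrow> 'v" where
  "head d \<equiv> tail (flip d)"

fun walk :: "'v \<Rightarrow> 'd list \<Rightarrow> 'v \<Rightarrow> bool" where
  "walk a [] b \<longleftrightarrow> a = b"
| "walk a (d # p) b \<longleftrightarrow> tail d = a \<and> walk (head d) p b"

definition reduced :: "'d list \<Rightarrow> bool" where
  "reduced = successively (\<lambda>d d'. d' \<noteq> flip d)"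

lemma flip_eq_iff [simp]: "flip d = flip d' \<longleftrightarrow> d = d'"
  by (metis flip_flip)

lemma inj_on_flip: "inj_on flip A"
  by (simp add: inj_on_def)

lemma reduced_simps [simp]:
  "reduced []" "reduced [d]"
  "reduced (d # d' # p) \<longleftrightarrow> d' \<noteq> flip d \<and> reduced (d' # p)"
  by (auto simp: reduced_def)

lemma reduced_appendD: "reduced (p @ q) \<Longrightarrow> reduced p \<and> reduced q"
  by (auto simp: reduced_def successively_append_iff)

lemma reduced_ConsD: "reduced (d # p) \<Longrightarrow> reduced p"
  by (cases p) auto

lemma walk_append: "walk a (p @ q) b \<longleftrightarrow> (\<exists>c. walk a p c \<and> walk c q b)"
  by (induction p arbitrary: a) auto

lemma walk_end_unique: "walk a p b \<Longrightarrow> walk a p c \<Longrightarrow> b = c"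
  by (induction p arbitrary: a) auto

lemma walk_relpow:
  assumes "walk a p b" "\<And>d. d \<in> set p \<Longrightarrow> (tail d, head d) \<in> R"
  shows "(a, b) \<in> R ^^ length p"
  using assms
proof (induction p arbitrary: a)
  case (Cons d p)
  then have "(a, head d) \<in> R" "(head d, b) \<in> R ^^ length p" by auto
  then show ?case using relpow_Suc_I2 by (metis length_Cons)
qed auto

end

subsection \<open>Reduced walks in a tree with at most one additional edge\<close>

text \<open>\<open>T\<close> holds the parent-to-child darts of a rooted forest:
  \<open>head_inj\<close> gives each vertex at most one parent, and \<open>height_head\<close>
  excludes cycles.\<close>

locale height_tree = dart_graph tail flip
  for tail :: "'d \<Rightarrow> 'v" and flip :: "'d \<Rightarrow> 'd" +
  fixes T :: "'d set" and height :: "'v \<Rightarrow> nat"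
  assumes height_head: "d \<in> T \<Longrightarrow> height (head d) = Suc (height (tail d))"
    and head_inj: "d \<in> T \<Longrightarrow> d' \<in> T \<Longrightarrow> head d = head d' \<Longrightarrow> d = d'"
begin

definition tree_darts :: "'d set" where
  "tree_darts = T \<union> flip ` T"

lemma flip_not_in_T: "d \<in> T \<Longrightarrow> flip d \<notin> T"
  using height_head[of d] height_head[of "flip d"] by auto

text \<open>After a step down to a child, the only way up is the child's unique parent edge, and
  taking it would backtrack.\<close>

lemma reduced_walk_down:
  assumes "walk a (d # p) b" "reduced (d # p)" "set (d # p) \<subseteq> tree_darts" "d \<in> T"
  shows "set p \<subseteq> T \<and> height b = height a + Suc (length p)"
  using assms
proof (induction p arbitrary: a d)
  case Nil
  then show ?case by (auto simp: height_head)
next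
  case (Cons d' p)
  have "d' \<in> T"
  proof (rule ccontr)
    assume "d' \<notin> T"
    with Cons.prems obtain t where "t \<in> T" "d' = flip t" by (auto simp: tree_darts_def)
    with Cons.prems head_inj[of t d] show False by auto
  qed
  with Cons.IH[of "head d" d'] Cons.prems show ?case by (auto simp: height_head)
qed

text \<open>An earlier step down would, by \<open>reduced_walk_down\<close>, force the last dart
  down too; hence every dart goes up.\<close>

lemma reduced_walk_up:
  assumes "walk a (p @ [d]) b" "reduced (p @ [d])" "set (p @ [d]) \<subseteq> tree_darts" "d \<notin> T"
  shows "height a = height b + Suc (length p)"
  using assms
proof (induction p arbitrary: a)
  case Nil
  then show ?case by (auto simp: tree_darts_def height_head)
next
  case (Cons d' p)
  have "d' \<notin> T"
    using reduced_walk_down[of a d' "p @ [d]" b] Cons.prems by auto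
  then obtain t where "t \<in> T" "d' = flip t" using Cons.prems by (auto simp: tree_darts_def)
  moreover have "height (head d') = height b + Suc (length p)"
    using Cons.IH[of "head d'"] Cons.prems reduced_ConsD[of d' "p @ [d]"] by auto
  ultimately show ?case using Cons.prems by (auto simp: height_head)
qed

lemma up_dart_unique:
  assumes "d \<in> tree_darts - T" "d' \<in> tree_darts - T" "tail d = tail d'"
  shows "d = d'"
  using assms head_inj by (auto simp: tree_darts_def)

text \<open>A walk that starts down or ends up changes the height, so a nonempty closed one starts
  up and ends down. Both steps use the parent edge of \<open>a\<close>, and what lies between is a
  shorter closed walk.\<close>

lemma reduced_closed_walk_Nil:
  assumes "walk a p a" "reduced p" "set p \<subseteq> tree_darts"
  shows "p = []"
  using assms
proof (induction "length p" arbitrary: a p rule: less_induct)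
  case less
  show ?case
  proof (rule ccontr)
    assume "p \<noteq> []"
    then obtain d q where p: "p = d # q" by (cases p) auto
    obtain q' d' where p': "p = q' @ [d']" using \<open>p \<noteq> []\<close> by (cases p rule: rev_cases) auto
    have d: "d \<in> tree_darts - T"
      using reduced_walk_down[of a d q a] less.prems p by auto
    have d': "d' \<in> T"
      using reduced_walk_up[of a q' d' a] less.prems p' by auto
    have "q' \<noteq> []" using p p' d d' by auto
    then obtain m where m: "p = d # m @ [d']" using p p' by (cases q') auto
    have "d = flip d'"
      using d d' less.prems m flip_not_in_T[of d']
      by (intro up_dart_unique) (auto simp: tree_darts_def walk_append)
    moreover have "m = []"
    proof (rule less.hyps)
      show "walk (head d) m (head d)"
        using less.prems m \<open>d = flip d'\<close> by (auto simp: walk_append)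
      show "reduced m" using less.prems m by (auto dest: reduced_ConsD reduced_appendD)
    qed (use less.prems m in auto)
    ultimately show False using less.prems m by auto
  qed
qed

text \<open>Two walks that both start up share their first dart, and two that both end down share
  their last, so a dart can be removed from both. Otherwise one walk only descends and the other
  only climbs, which the heights rule out.\<close>

lemma reduced_walk_unique:
  assumes "walk a p b" "reduced p" "set p \<subseteq> tree_darts"
    and "walk a q b" "reduced q" "set q \<subseteq> tree_darts"
  shows "p = q"
  using assms
proof (induction "length p" arbitrary: a b p q rule: less_induct)
  case less
  show ?case
  proof (cases "p = [] \<or> q = []")
    case True
    then show ?thesis
      using less.prems reduced_closed_walk_Nil[of a p] reduced_closed_walk_Nil[of a q] by auto
  next
    case False
    then obtain d p' e q' where p: "p = d # p'" and q: "q = e # q'"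
      by (meson neq_Nil_conv)
    obtain p'' d' q'' e' where p'': "p = p'' @ [d']" and q'': "q = q'' @ [e']"
      using False by (metis rev_exhaust)
    have "d' \<in> T" if "d \<in> T"
      using reduced_walk_down[of a d p' b] reduced_walk_up[of a p'' d' b] less.prems p p'' that
      by fastforce
    moreover have "e' \<in> T" if "e \<in> T"
      using reduced_walk_down[of a e q' b] reduced_walk_up[of a q'' e' b] less.prems q q'' that
      by fastforce
    ultimately consider "d \<notin> T" "e \<notin> T" | "d' \<in> T" "e' \<in> T" | "d \<in> T" "e' \<notin> T" | "e \<in> T" "d' \<notin> T"
      by blast
    then show ?thesis
    proof cases
      case 1
      then have "d = e" using less.prems p q by (intro up_dart_unique) auto
      with less.hyps[of p' "head d" b q'] less.prems p q show ?thesis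
        by (auto dest: reduced_ConsD)
    next
      case 2
      then have "d' = e'" using less.prems p'' q'' by (intro head_inj) (auto simp: walk_append)
      with less.hyps[of p'' a "tail d'" q''] less.prems p'' q'' show ?thesis
        by (auto simp: walk_append dest: reduced_appendD)
    next
      case 3
      with reduced_walk_down[of a d p' b] reduced_walk_up[of a q'' e' b] less.prems p q''
      show ?thesis by auto
    next
      case 4
      with reduced_walk_down[of a e q' b] reduced_walk_up[of a p'' d' b] less.prems p'' q
      show ?thesis by auto
    qed
  qed
qed

text \<open>Between the first \<open>flip f\<close> and the last \<open>f\<close> before it, the
  walk is closed and stays in the tree, hence is empty; so \<open>f\<close> would be reversed at
  once.\<close>

lemma extra_dart_direction:
  assumes "walk a p b" "reduced p" "set p \<subseteq> tree_darts \<union> {f, flip f}" "hd p = f" "f \<noteq> flip f"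
  shows "p = [] \<or> flip f \<notin> set p"
proof (rule ccontr)
  assume "\<not> ?thesis"
  then have "p \<noteq> []" "flip f \<in> set p" by auto
  then obtain x y where p: "p = x @ flip f # y" "flip f \<notin> set x" by (meson split_list_first)
  have "f \<in> set x" using p \<open>hd p = f\<close> \<open>f \<noteq> flip f\<close> by (cases x) auto
  then obtain x1 s where x: "x = x1 @ f # s" "f \<notin> set s" by (meson split_list_last)
  have p: "p = x1 @ (f # s @ [flip f]) @ y" using p x by simp
  have "reduced (f # s @ [flip f])" using assms(2) unfolding p by (blast dest: reduced_appendD)
  moreover have "s = []"
  proof (rule reduced_closed_walk_Nil)
    show "walk (head f) s (head f)" using assms(1) unfolding p by (auto simp: walk_append)
    show "reduced s" using \<open>reduced (f # s @ [flip f])\<close> by (auto dest: reduced_ConsD reduced_appendD)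
    show "set s \<subseteq> tree_darts" using assms(3) x p \<open>flip f \<notin> set x\<close> by auto
  qed
  ultimately show False by simp
qed

text \<open>Cut at the last \<open>f\<close>: the remainders are tree walks from
  \<open>head f\<close> to \<open>b\<close>, hence equal, and the prefixes are shorter walks of
  equal length ending at \<open>tail f\<close>.\<close>

lemma reduced_walk_unique_extra:
  assumes "walk a p b" "reduced p" "set p \<subseteq> tree_darts \<union> {f}" "p \<noteq> [] \<Longrightarrow> hd p = f"
    and "walk a q b" "reduced q" "set q \<subseteq> tree_darts \<union> {f}" "q \<noteq> [] \<Longrightarrow> hd q = f"
    and "length p = length q"
  shows "p = q"
  using assms
proof (induction "length p" arbitrary: b p q rule: less_induct)
  case less
  show ?case
  proof (cases "p = []")
    case True
    then show ?thesis using less.prems by simp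
  next
    case False
    then have ne: "p \<noteq> []" "q \<noteq> []" using less.prems by auto
    then have "f \<in> set p" "f \<in> set q" using less.prems hd_in_set by metis+
    then obtain x s y t where p: "p = x @ f # s" "f \<notin> set s" and q: "q = y @ f # t" "f \<notin> set t"
      by (meson split_list_last)
    have "s = t"
      using less.prems p q
      by (intro reduced_walk_unique[of "head f" s b t])
        (auto simp: walk_append dest!: reduced_appendD reduced_ConsD)
    moreover have "x = y"
    proof (rule less.hyps)
      show "reduced x" "reduced y"
        using reduced_appendD[of x "f # s"] reduced_appendD[of y "f # t"] less.prems(2,6) p q by auto
      show "walk a x (tail f)" "walk a y (tail f)" using less.prems p q by (auto simp: walk_append)
      show "hd x = f" if "x \<noteq> []" using less.prems(4) p ne that by simp
      show "hd y = f" if "y \<noteq> []" using less.prems(8) q ne that by simp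
    qed (use less.prems p q \<open>s = t\<close> in auto)
    ultimately show ?thesis using p q by simp
  qed
qed

text \<open>All occurrences of the extra edge in a reduced walk have the same direction, and between two
  of them the walk runs once around the unique cycle, so the length fixes how often it does so.\<close>

lemma reduced_walk_determined:
  assumes f: "f \<noteq> flip f"
    and p: "walk a p b" "reduced p" "set p \<subseteq> tree_darts \<union> {f, flip f}"
    and q: "walk a q b" "reduced q" "set q \<subseteq> tree_darts \<union> {f, flip f}"
    and len: "length p = length q"
    and first: "find (\<lambda>d. d \<in> {f, flip f}) p = find (\<lambda>d. d \<in> {f, flip f}) q"
  shows "p = q"
proof (cases "find (\<lambda>d. d \<in> {f, flip f}) p")
  case None
  then have "f \<notin> set p" "flip f \<notin> set p" "f \<notin> set q" "flip f \<notin> set q"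
    using None None[unfolded first] unfolding find_None_iff by auto
  then show ?thesis using p q by (intro reduced_walk_unique[of a p b q]) auto
next
  case (Some g)
  have split: "\<exists>x y. z = x @ g # y \<and> g \<in> {f, flip f} \<and> set x \<inter> {f, flip f} = {}"
    if "find (\<lambda>d. d \<in> {f, flip f}) z = Some g" for z
    using that
  proof (induction z)
    case (Cons d z)
    show ?case
    proof (cases "d \<in> {f, flip f}")
      case True
      then show ?thesis using Cons.prems by (intro exI[of _ "[]"] exI[of _ z]) auto
    next
      case False
      with Cons obtain x y where "z = x @ g # y" "g \<in> {f, flip f}" "set x \<inter> {f, flip f} = {}"
        by auto
      with False show ?thesis by (intro exI[of _ "d # x"] exI[of _ y]) auto
    qed
  qed auto
  obtain x s where x: "p = x @ g # s" "g \<in> {f, flip f}" "set x \<inter> {f, flip f} = {}"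
    using split Some by blast
  obtain y t where y: "q = y @ g # t" "set y \<inter> {f, flip f} = {}"
    using split Some first by metis
  have gf: "{g, flip g} = {f, flip f}" "g \<noteq> flip g" using x(2) f by auto
  \<comment> \<open>Before the first use of the extra edge both walks stay in the tree and lead to
    \<open>tail g\<close>.\<close>
  have "x = y"
    using p q x y
    by (intro reduced_walk_unique[of a x "tail g" y]) (auto simp: walk_append dest: reduced_appendD)
  moreover have "g # s = g # t"
  proof (rule reduced_walk_unique_extra)
    show "walk (tail g) (g # s) b" "walk (tail g) (g # t) b"
      using p q x y by (auto simp: walk_append)
    show r: "reduced (g # s)" "reduced (g # t)"
      using p q x y by (auto dest: reduced_appendD)
    have "set (g # s) \<subseteq> tree_darts \<union> {g, flip g}" "set (g # t) \<subseteq> tree_darts \<union> {g, flip g}"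
      using p q x y gf by auto
    \<comment> \<open>Having started with \<open>g\<close>, neither remainder can use
      \<open>flip g\<close>.\<close>
    moreover from this have "flip g \<notin> set (g # s)" "flip g \<notin> set (g # t)"
      using extra_dart_direction[of "tail g" "g # s" b g] extra_dart_direction[of "tail g" "g # t" b g]
        \<open>walk (tail g) (g # s) b\<close> \<open>walk (tail g) (g # t) b\<close> r gf by auto
    ultimately show "set (g # s) \<subseteq> tree_darts \<union> {g}" "set (g # t) \<subseteq> tree_darts \<union> {g}"
      by auto
  qed (use len x y \<open>x = y\<close> in auto)
  ultimately show ?thesis using x y by simp
qed

lemma card_reduced_walks_le:
  assumes f: "f \<noteq> flip f" and "finite W"
    and P: "\<And>p. p \<in> P \<Longrightarrow> reduced p \<and> length p = n \<and> set p \<subseteq> tree_darts \<union> {f, flip f} \<and>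
                  (\<exists>b\<in>W. walk a p b)"
  shows "card P \<le> 3 * card W"
proof -
  \<comment> \<open>By \<open>reduced_walk_determined\<close> this pair identifies the walk, and its
    second component has only three values.\<close>
  define \<phi> where "\<phi> p = ((THE b. walk a p b), find (\<lambda>d. d \<in> {f, flip f}) p)" for p
  have the: "(THE b. walk a p b) = b" if "walk a p b" for p b
    using that by (rule the_equality) (rule walk_end_unique[OF _ that])
  have inj: "inj_on \<phi> P"
  proof (rule inj_onI)
    fix p q assume "p \<in> P" "q \<in> P" "\<phi> p = \<phi> q"
    with P[of p] P[of q] the show "p = q"
      by (intro reduced_walk_determined[OF f, of a p "THE b. walk a p b" q]) (auto simp: \<phi>_def)
  qed
  have sub: "\<phi> ` P \<subseteq> W \<times> {None, Some f, Some (flip f)}"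
  proof
    fix z assume "z \<in> \<phi> ` P"
    then obtain p where p: "p \<in> P" "z = \<phi> p" by blast
    obtain b where "b \<in> W" "walk a p b" using P p by blast
    moreover have "find (\<lambda>d. d \<in> {f, flip f}) p \<in> {None, Some f, Some (flip f)}"
      by (induction p) auto
    ultimately show "z \<in> W \<times> {None, Some f, Some (flip f)}" by (simp add: p(2) \<phi>_def the)
  qed
  have fin: "finite (W \<times> {None, Some f, Some (flip f)})" using \<open>finite W\<close> by simp
  have "card P \<le> card (W \<times> {None, Some f, Some (flip f)})"
    using inj sub fin by (rule card_inj_on_le)
  also have "\<dots> \<le> card W * 3"
    unfolding card_cartesian_product by (intro mult_le_mono2) (auto simp: card_insert_if)
  finally show "card P \<le> 3 * card W" by simp
qed

end

subsection \<open>Counting reduced walks\<close>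

text \<open>Jensen's inequality for \<open>ln\<close>, with \<open>ln (card A)\<close> turning the
  mean of the \<open>y i\<close> into their sum.\<close>

lemma card_mult_mean_ln_le:
  fixes y :: "'a \<Rightarrow> real"
  assumes "finite A" "A \<noteq> {}" "\<And>i. i \<in> A \<Longrightarrow> y i > 0"
  shows "ln (card A) + (\<Sum>i\<in>A. ln (y i)) / card A \<le> ln (\<Sum>i\<in>A. y i)"
proof -
  define n where "n = real (card A)"
  define m where "m = (\<Sum>i\<in>A. y i) / n"
  have n: "n > 0" using assms by (simp add: n_def card_gt_0_iff)
  have S: "(\<Sum>i\<in>A. y i) > 0" using assms by (intro sum_pos) auto
  then have m: "m > 0" using n by (simp add: m_def)
  \<comment> \<open>Bounds \<open>ln\<close> by its tangent at the mean \<open>m\<close>; the linear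
    terms cancel in the sum.\<close>
  have "(\<Sum>i\<in>A. ln (y i)) \<le> (\<Sum>i\<in>A. y i / m - 1 + ln m)"
  proof (rule sum_mono)
    fix i assume "i \<in> A"
    then show "ln (y i) \<le> y i / m - 1 + ln m"
      using ln_le_minus_one[of "y i / m"] assms(3)[of i] m by (simp add: ln_div)
  qed
  also have "\<dots> = (\<Sum>i\<in>A. y i) / m - n + n * ln m"
    by (simp add: sum.distrib sum_subtractf sum_divide_distrib n_def)
  also have "\<dots> = n * ln m" using S n by (simp add: m_def)
  finally have "(\<Sum>i\<in>A. ln (y i)) / n \<le> ln m" using n by (simp add: field_simps)
  moreover have "ln m = ln (\<Sum>i\<in>A. y i) - ln n" using S n by (simp add: m_def ln_div)
  ultimately show ?thesis by (simp add: n_def)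
qed

text \<open>Divided by \<open>m\<close>, with \<open>y = m - 1\<close>, this reads
  \<open>ln y + 4 / (y + 1) >= 2\<close>. Equality holds at \<open>y = 1\<close>, and the derivative
  of the left side is \<open>(y - 1)^2 / (y * (y + 1)^2)\<close>.\<close>

lemma ln_pred_ge:
  fixes m :: nat
  assumes "m \<ge> 2"
  shows "2 * (real m - 2) \<le> real m * ln (real m - 1)"
proof -
  define f :: "real \<Rightarrow> real" where "f y = ln y + 4 / (y + 1)" for y
  have "f 1 \<le> f (real m - 1)"
  proof (rule DERIV_nonneg_imp_nondecreasing[of _ _ f])
    fix y :: real assume y: "1 \<le> y" "y \<le> real m - 1"
    have "(f has_real_derivative (1 / y - 4 / (y + 1)\<^sup>2)) (at y)"
      unfolding f_def using y
      by (auto intro!: derivative_eq_intros simp: power2_eq_square divide_inverse)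
    moreover have "1 / y - 4 / (y + 1)\<^sup>2 = (y - 1)\<^sup>2 / (y * (y + 1)\<^sup>2)"
      using y by (simp add: field_simps) (simp add: power2_eq_square algebra_simps)
    ultimately show "\<exists>D. (f has_real_derivative D) (at y) \<and> D \<ge> 0"
      using y by (intro exI[of _ "1 / y - 4 / (y + 1)\<^sup>2"]) auto
  qed (use assms in auto)
  then have "2 - 4 / real m \<le> ln (real m - 1)" by (simp add: f_def)
  then have "real m * (2 - 4 / real m) \<le> real m * ln (real m - 1)"
    by (intro mult_left_mono) auto
  then show ?thesis using assms by (simp add: algebra_simps)
qed

section \<open>Counting walks by averaging over darts\<close>

locale finite_dart_graph = dart_graph tail flip
  for tail :: "'d \<Rightarrow> 'v" and flip :: "'d \<Rightarrow> 'd" +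
  fixes D :: "'d set"
  assumes finite_D: "finite D"
    and flip_in_D: "d \<in> D \<Longrightarrow> flip d \<in> D"
begin

definition deg :: "'v \<Rightarrow> nat" where
  "deg x = card {d \<in> D. tail d = x}"

definition succs :: "'d \<Rightarrow> 'd set" where
  "succs d = {d' \<in> D. tail d' = head d \<and> d' \<noteq> flip d}"

text \<open>The index counts the darts that follow \<open>d\<close>, so a walk in
  \<open>reduced_walks k d\<close> has \<open>Suc k\<close> darts.\<close>

fun reduced_walks :: "nat \<Rightarrow> 'd \<Rightarrow> 'd list set" where
  "reduced_walks 0 d = {[d]}"
| "reduced_walks (Suc k) d = (\<Union>d'\<in>succs d. (#) d ` reduced_walks k d')"

lemma finite_succs: "finite (succs d)"
  using finite_D by (simp add: succs_def)

lemma card_succs: "d \<in> D \<Longrightarrow> card (succs d) = deg (head d) - 1"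
proof -
  assume d: "d \<in> D"
  have "succs d = {d' \<in> D. tail d' = head d} - {flip d}" by (auto simp: succs_def)
  then show ?thesis using d flip_in_D finite_D by (simp add: deg_def)
qed

text \<open>Reversal maps the predecessors of \<open>d\<close> to the successors of
  \<open>flip d\<close>.\<close>

lemma card_preds: "d \<in> D \<Longrightarrow> card {c \<in> D. d \<in> succs c} = deg (tail d) - 1"
proof -
  assume d: "d \<in> D"
  have "{c \<in> D. d \<in> succs c} = flip ` succs (flip d)"
  proof (intro set_eqI iffI)
    fix c assume "c \<in> {c \<in> D. d \<in> succs c}"
    then have "flip c \<in> succs (flip d)" using flip_in_D by (auto simp: succs_def)
    then show "c \<in> flip ` succs (flip d)" by (metis flip_flip imageI)
  next
    fix c assume "c \<in> flip ` succs (flip d)"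
    then show "c \<in> {c \<in> D. d \<in> succs c}" using d flip_in_D by (auto simp: succs_def)
  qed
  then show ?thesis
    using d flip_in_D card_succs[of "flip d"] by (simp add: card_image inj_on_flip)
qed

lemma reduced_walks_props:
  assumes "d \<in> D" "p \<in> reduced_walks k d"
  shows "reduced p \<and> length p = Suc k \<and> set p \<subseteq> D \<and> hd p = d \<and> (\<exists>b. walk (tail d) p b)"
  using assms
proof (induction k arbitrary: d p)
  case (Suc k)
  then obtain d' q where q: "d' \<in> succs d" "q \<in> reduced_walks k d'" "p = d # q" by auto
  with Suc.IH[of d' q]
  have "reduced q \<and> length q = Suc k \<and> set q \<subseteq> D \<and> hd q = d' \<and> (\<exists>b. walk (tail d') q b)"
    by (auto simp: succs_def)
  with q Suc.prems show ?case by (cases q) (auto simp: succs_def)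
qed auto

lemma reduced_walks_Cons: "p \<in> reduced_walks k d \<Longrightarrow> \<exists>q. p = d # q"
  by (cases k) auto

lemma finite_reduced_walks: "finite (reduced_walks k d)"
  by (induction k arbitrary: d) (auto simp: finite_succs)

lemma card_reduced_walks_Suc:
  "card (reduced_walks (Suc k) d) = (\<Sum>d'\<in>succs d. card (reduced_walks k d'))"
proof -
  have "card (reduced_walks (Suc k) d) = (\<Sum>d'\<in>succs d. card ((#) d ` reduced_walks k d'))"
    unfolding reduced_walks.simps
    by (intro card_UN_disjoint) (auto simp: finite_succs finite_reduced_walks dest: reduced_walks_Cons)
  then show ?thesis by (simp add: card_image)
qed

context
  assumes deg_ge_2: "\<And>d. d \<in> D \<Longrightarrow> deg (tail d) \<ge> 2"
begin

lemma succs_nonempty: "d \<in> D \<Longrightarrow> succs d \<noteq> {}"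
  using card_succs[of d] deg_ge_2[of "flip d"] flip_in_D[of d] by fastforce

lemma reduced_walks_nonempty: "d \<in> D \<Longrightarrow> reduced_walks k d \<noteq> {}"
proof (induction k arbitrary: d)
  case (Suc k)
  then obtain d' where "d' \<in> succs d" using succs_nonempty by blast
  with Suc.IH[of d'] show ?case by (auto simp: succs_def)
qed auto

text \<open>The uniform distribution on darts is stationary for the non-backtracking random walk.\<close>

lemma sum_succs_average:
  fixes g :: "'d \<Rightarrow> real"
  shows "(\<Sum>d\<in>D. (\<Sum>d'\<in>succs d. g d') / card (succs d)) = (\<Sum>d\<in>D. g d)"
proof -
  have "(\<Sum>d\<in>D. (\<Sum>d'\<in>succs d. g d') / card (succs d))
      = (\<Sum>d\<in>D. \<Sum>d'\<in>{d'. d' \<in> D \<and> d' \<in> succs d}. g d' / card (succs d))"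
    unfolding sum_divide_distrib by (intro sum.cong) (auto simp: succs_def)
  also have "\<dots> = (\<Sum>d'\<in>D. \<Sum>d\<in>{d. d \<in> D \<and> d' \<in> succs d}. g d' / card (succs d))"
    using finite_D by (rule sum.swap_restrict) (rule finite_D)
  also have "\<dots> = (\<Sum>d'\<in>D. g d')"
  proof (rule sum.cong)
    fix d' assume d': "d' \<in> D"
    \<comment> \<open>Each predecessor of \<open>d'\<close> has \<open>deg (tail d') - 1\<close>
      successors, and there are as many predecessors, so the weights add up to one.\<close>
    have "(\<Sum>d\<in>{d. d \<in> D \<and> d' \<in> succs d}. g d' / card (succs d))
        = (\<Sum>d\<in>{d. d \<in> D \<and> d' \<in> succs d}. g d' / (deg (tail d') - 1))"
    proof (rule sum.cong)
      fix d assume d: "d \<in> {d. d \<in> D \<and> d' \<in> succs d}"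
      then have "tail d' = head d" by (simp add: succs_def)
      with d show "g d' / card (succs d) = g d' / (deg (tail d') - 1)" by (simp add: card_succs)
    qed simp
    also have "\<dots> = (deg (tail d') - 1) * (g d' / (deg (tail d') - 1))"
      using card_preds[OF d'] by simp
    also have "\<dots> = g d'" using deg_ge_2[OF d'] by simp
    finally show "(\<Sum>d\<in>{d. d \<in> D \<and> d' \<in> succs d}. g d' / card (succs d)) = g d'" .
  qed simp
  finally show ?thesis .
qed

text \<open>Split off the first step: Jensen's inequality over \<open>succs d\<close> yields the
  logarithm of the number of choices plus a mean over successors, and by stationarity these means
  sum to the total for \<open>k\<close>.\<close>

lemma sum_ln_card_reduced_walks_ge:
  "real k * (\<Sum>d\<in>D. ln (card (succs d))) \<le> (\<Sum>d\<in>D. ln (card (reduced_walks k d)))"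
proof (induction k)
  case (Suc k)
  have "real (Suc k) * (\<Sum>d\<in>D. ln (card (succs d)))
      \<le> (\<Sum>d\<in>D. ln (card (succs d))) + (\<Sum>d\<in>D. ln (card (reduced_walks k d)))"
    using Suc.IH by (simp add: algebra_simps)
  also have "\<dots> = (\<Sum>d\<in>D. ln (card (succs d)) +
      (\<Sum>d'\<in>succs d. ln (card (reduced_walks k d'))) / card (succs d))"
    by (simp add: sum.distrib sum_succs_average)
  also have "\<dots> \<le> (\<Sum>d\<in>D. ln (card (reduced_walks (Suc k) d)))"
  proof (rule sum_mono)
    fix d assume d: "d \<in> D"
    show "ln (card (succs d)) + (\<Sum>d'\<in>succs d. ln (card (reduced_walks k d'))) / card (succs d)
        \<le> ln (card (reduced_walks (Suc k) d))"
      unfolding card_reduced_walks_Suc of_nat_sum using succs_nonempty[OF d]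
    proof (intro card_mult_mean_ln_le)
      fix d' assume "d' \<in> succs d"
      then have "d' \<in> D" by (simp add: succs_def)
      then show "0 < real (card (reduced_walks k d'))"
        by (simp add: card_gt_0_iff finite_reduced_walks reduced_walks_nonempty)
    qed (auto simp: finite_succs)
  qed
  finally show ?case .
qed simp

text \<open>Reversal turns heads into tails; grouping the darts by tail gives each vertex the term
  \<open>deg x * ln (deg x - 1)\<close>, to which \<open>ln_pred_ge\<close> applies. For the darts
  of a graph on \<open>S\<close> the left side is four times the excess.\<close>

lemma sum_ln_card_succs_ge:
  assumes "finite S" "tail ` D \<subseteq> S" "\<And>x. x \<in> S \<Longrightarrow> deg x \<ge> 2"
  shows "2 * real (card D) - 4 * real (card S) \<le> (\<Sum>d\<in>D. ln (card (succs d)))"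
proof -
  have flip_D: "flip ` D = D" 
  proof
    show "D \<subseteq> flip ` D"
    proof
      fix d assume "d \<in> D"
      then have "flip d \<in> D" by (rule flip_in_D)
      then have "flip (flip d) \<in> flip ` D" by (rule imageI)
      then show "d \<in> flip ` D" by simp
    qed
  qed (use flip_in_D in auto)
  have "(\<Sum>d\<in>D. ln (card (succs d))) = (\<Sum>d\<in>D. ln (real (deg (head d)) - 1))"
  proof (rule sum.cong)
    fix d assume d: "d \<in> D"
    with deg_ge_2[OF flip_in_D[OF d]] show "ln (card (succs d)) = ln (real (deg (head d)) - 1)"
      by (simp add: card_succs of_nat_diff)
  qed simp
  also have "\<dots> = (\<Sum>d\<in>flip ` D. ln (real (deg (tail d)) - 1))"
    by (simp add: sum.reindex inj_on_flip)
  also have "\<dots> = (\<Sum>x\<in>S. \<Sum>d\<in>{d. d \<in> D \<and> tail d = x}. ln (real (deg (tail d)) - 1))"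
    unfolding flip_D by (rule sum.group[OF finite_D assms(1,2), symmetric])
  also have "\<dots> = (\<Sum>x\<in>S. real (deg x) * ln (real (deg x) - 1))"
    by (intro sum.cong) (auto simp: deg_def)
  finally have "(\<Sum>d\<in>D. ln (card (succs d))) = (\<Sum>x\<in>S. real (deg x) * ln (real (deg x) - 1))" .
  moreover have "(\<Sum>x\<in>S. 2 * (real (deg x) - 2)) \<le> (\<Sum>x\<in>S. real (deg x) * ln (real (deg x) - 1))"
    using assms by (intro sum_mono ln_pred_ge) auto
  moreover have "(\<Sum>x\<in>S. deg x) = card D"
    using sum.group[OF finite_D assms(1,2), of "\<lambda>_. 1 :: nat"] by (simp add: deg_def)
  then have "(\<Sum>x\<in>S. real (deg x)) = card D" by (metis of_nat_sum)
  ultimately show ?thesis by (simp add: sum_subtractf flip: sum_distrib_left)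
qed

end

end

subsection \<open>Darts of a multigraph\<close>

text \<open>A loop has two darts as well, so it contributes two to the degree of its vertex.\<close>

definition orientation :: "('e \<Rightarrow> 'v uprod) \<Rightarrow> 'e \<Rightarrow> 'v \<times> 'v" where
  "orientation \<epsilon> e = (SOME ab. \<epsilon> e = Upair (fst ab) (snd ab))"

definition dart_tail :: "('e \<Rightarrow> 'v uprod) \<Rightarrow> 'e \<times> bool \<Rightarrow> 'v" where
  "dart_tail \<epsilon> d = (if snd d then fst else snd) (orientation \<epsilon> (fst d))"

text \<open>The Boolean keeps the two darts of a loop distinct although they share their tail, so
  flipping has no fixed point.\<close>

definition dart_flip :: "'e \<times> bool \<Rightarrow> 'e \<times> bool" where
  "dart_flip d = (fst d, \<not> snd d)"

lemma fst_dart_flip [simp]: "fst (dart_flip d) = fst d"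
  by (simp add: dart_flip_def)

lemma dart_flip_neq: "d \<noteq> dart_flip d"
  by (simp add: dart_flip_def prod_eq_iff)

lemma same_edge_dart: "fst d = fst d' \<Longrightarrow> d = d' \<or> d = dart_flip d'"
  by (auto simp: dart_flip_def prod_eq_iff)

lemma ends_orientation: "\<epsilon> e = Upair (fst (orientation \<epsilon> e)) (snd (orientation \<epsilon> e))"
proof -
  obtain a b where "\<epsilon> e = Upair a b" by (cases "\<epsilon> e")
  then have "\<epsilon> e = Upair (fst (a, b)) (snd (a, b))" by simp
  then show ?thesis unfolding orientation_def by (rule someI)
qed

lemma ends_dart: "\<epsilon> (fst d) = Upair (dart_tail \<epsilon> d) (dart_tail \<epsilon> (dart_flip d))"
  by (subst ends_orientation) (simp add: dart_tail_def dart_flip_def)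

lemma obtain_dart:
  assumes "\<epsilon> e = Upair a b"
  obtains d where "fst d = e" "dart_tail \<epsilon> d = a" "dart_tail \<epsilon> (dart_flip d) = b"
proof -
  let ?d = "(e, True)"
  have "Upair a b = Upair (dart_tail \<epsilon> ?d) (dart_tail \<epsilon> (dart_flip ?d))"
    using assms ends_dart[of \<epsilon> ?d] by simp
  then show ?thesis
    using that[of ?d] that[of "dart_flip ?d"] by (auto simp: dart_flip_def)
qed

locale finite_multigraph_darts =
  fixes G :: "('v, 'e) multigraph"
  assumes finite_G: "finite_multigraph G"
begin

sublocale dart_graph "dart_tail (ends G)" dart_flip
  by unfold_locales (simp add: dart_flip_def)

abbreviation dtail :: "'e \<times> bool \<Rightarrow> 'v" where
  "dtail \<equiv> dart_tail (ends G)"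

lemma finite_verts: "finite (verts G)"
  and finite_edges: "finite (edges G)"
  and ends_subset: "e \<in> edges G \<Longrightarrow> set_uprod (ends G e) \<subseteq> verts G"
  using finite_G by (auto simp: finite_multigraph_def)

lemma set_ends_dart: "set_uprod (ends G (fst d)) = {dtail d, head d}"
  by (simp add: ends_dart[of "ends G" d])

lemma verts_nonempty:
  assumes "exc G > 0"
  shows "verts G \<noteq> {}"
proof -
  have "edges G \<noteq> {}" using assms by (auto simp: exc_def)
  then obtain e where "e \<in> edges G" by blast
  then show ?thesis using ends_subset[of e] set_ends_dart[of "(e, True)"] by auto
qed

lemma dart_adj: "fst d \<in> edges G \<Longrightarrow> (dtail d, head d) \<in> adj G"
  using ends_dart[of "ends G" d] by (auto simp: adj_def)

lemma graph_dist_le_iff: "graph_dist G u w \<le> enat r \<longleftrightarrow> (\<exists>n\<le>r. (u, w) \<in> adj G ^^ n)"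
proof -
  \<comment> \<open>A strict bound on an infimum is witnessed by an element of the set, hence the
    passage to \<open>Suc r\<close>.\<close>
  have "graph_dist G u w \<le> enat r \<longleftrightarrow> graph_dist G u w < enat (Suc r)"
    by (cases "graph_dist G u w") auto
  also have "\<dots> \<longleftrightarrow> (\<exists>n\<le>r. (u, w) \<in> adj G ^^ n)"
    by (auto simp: graph_dist_def INF_less_iff less_Suc_eq_le)
  finally show ?thesis .
qed

section \<open>Balls and the walks inside them\<close>

definition ball_verts :: "'v \<Rightarrow> nat \<Rightarrow> 'v set" where
  "ball_verts u r = {w \<in> verts G. \<exists>n\<le>r. (u, w) \<in> adj G ^^ n}"

definition ball_edges :: "'v \<Rightarrow> nat \<Rightarrow> 'e set" where
  "ball_edges u r = {e \<in> edges G. set_uprod (ends G e) \<subseteq> ball_verts u r}"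

lemma exc_neighborhood:
  "exc (neighborhood G r u) = int (card (ball_edges u r)) - int (card (ball_verts u r))"
  by (simp add: exc_def neighborhood_def induced_subgraph_def ball_edges_def ball_verts_def
      graph_dist_le_iff)

lemma walk_end_in_ball:
  assumes "u \<in> verts G" "walk u p b" "fst ` set p \<subseteq> edges G" "length p \<le> r"
  shows "b \<in> ball_verts u r"
proof -
  have "(u, b) \<in> adj G ^^ length p" using assms by (intro walk_relpow dart_adj) auto
  moreover have "b \<in> verts G"
  proof (cases p rule: rev_cases)
    case (snoc q d)
    then have "b = head d" "fst d \<in> edges G" using assms by (auto simp: walk_append)
    then show ?thesis using ends_subset[of "fst d"] by (simp add: set_ends_dart)
  qed (use assms in auto)
  ultimately show ?thesis using assms by (auto simp: ball_verts_def)
qed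

text \<open>Both ends of \<open>d\<close> are ends of initial segments of the walk, hence lie in the
  ball.\<close>

lemma walk_edges_in_ball:
  assumes "u \<in> verts G" "walk u p b" "fst ` set p \<subseteq> edges G" "length p \<le> r" "d \<in> set p"
  shows "fst d \<in> ball_edges u r"
proof -
  obtain x y where p: "p = x @ d # y" using \<open>d \<in> set p\<close> by (meson split_list)
  have "dtail d \<in> ball_verts u r"
    using assms p by (intro walk_end_in_ball[of u x]) (auto simp: walk_append)
  moreover have "head d \<in> ball_verts u r"
    using assms p by (intro walk_end_in_ball[of u "x @ [d]"]) (auto simp: walk_append)
  ultimately show ?thesis using assms by (auto simp: ball_edges_def set_ends_dart)
qed

text \<open>A breadth-first search tree leaves at most one edge of a ball uncovered.\<close>

lemma card_ball_reduced_walks_le: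
  assumes u: "u \<in> verts G" and exc: "exc (neighborhood G r u) \<le> 0"
    and P: "\<And>p. p \<in> P \<Longrightarrow> reduced p \<and> length p = r \<and> fst ` set p \<subseteq> edges G \<and> (\<exists>b. walk u p b)"
  shows "card P \<le> 3 * card (verts G)"
proof -
  define W where "W = ball_verts u r"
  \<comment> \<open>The distance from \<open>u\<close>; it is arbitrary only at unreachable
    vertices, which lie outside the ball.\<close>
  define h where "h w = (LEAST n. (u, w) \<in> adj G ^^ n)" for w
  have finW: "finite W" using finite_verts by (simp add: W_def ball_verts_def)
  have "u \<in> W" unfolding W_def using u by (intro walk_end_in_ball[of u "[]"]) auto
  \<comment> \<open>The last step of a shortest walk to \<open>w\<close> serves as its parent
    dart.\<close>
  have ex: "\<exists>d. fst d \<in> ball_edges u r \<and> head d = w \<and> h w = Suc (h (dtail d))" if w: "w \<in> W - {u}" for w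
  proof -
    obtain n where n: "n \<le> r" "(u, w) \<in> adj G ^^ n" using w by (auto simp: W_def ball_verts_def)
    have hw: "(u, w) \<in> adj G ^^ h w" "h w \<le> r"
      unfolding h_def using n by (auto intro: LeastI Least_le order_trans)
    then obtain k where k: "h w = Suc k" using w by (cases "h w") auto
    then obtain x where x: "(u, x) \<in> adj G ^^ k" "(x, w) \<in> adj G" using hw by auto
    then obtain e where e: "e \<in> edges G" "ends G e = Upair x w" by (auto simp: adj_def)
    obtain d where d: "fst d = e" "dtail d = x" "head d = w" using e obtain_dart by metis
    have "x \<in> W"
      unfolding W_def using x k hw e ends_subset[of e] by (auto simp: ball_verts_def intro!: exI[of _ k])
    then have "fst d \<in> ball_edges u r" using w d e by (auto simp: ball_edges_def W_def)
    moreover have "h x \<le> k" unfolding h_def using x by (intro Least_le)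
    moreover have "(u, x) \<in> adj G ^^ h x" unfolding h_def using x by (intro LeastI)
    then have "(u, w) \<in> adj G ^^ Suc (h x)" using x by auto
    then have "h w \<le> Suc (h x)" unfolding h_def[of w] by (rule Least_le)
    ultimately show ?thesis using d k by (intro exI[of _ d]) auto
  qed
  have "\<exists>par. \<forall>w\<in>W - {u}.
      fst (par w) \<in> ball_edges u r \<and> head (par w) = w \<and> h w = Suc (h (dtail (par w)))"
    by (rule bchoice) (blast intro: ex)
  then obtain par where par: "\<And>w. w \<in> W - {u} \<Longrightarrow>
      fst (par w) \<in> ball_edges u r \<and> head (par w) = w \<and> h w = Suc (h (dtail (par w)))"
    by blast
  define T where "T = par ` (W - {u})"
  interpret height_tree dtail dart_flip T h
  proof
    show "h (head d) = Suc (h (dtail d))" if "d \<in> T" for d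
      using that par unfolding T_def by force
    show "d = d'" if "d \<in> T" "d' \<in> T" "head d = head d'" for d d'
      using that par unfolding T_def by force
  qed
  \<comment> \<open>Two vertices sharing a parent edge would put it into \<open>T\<close> in both
    directions, which the heights forbid.\<close>
  have "inj_on (fst \<circ> par) (W - {u})"
  proof (rule inj_onI)
    fix w w' assume w: "w \<in> W - {u}" "w' \<in> W - {u}" "(fst \<circ> par) w = (fst \<circ> par) w'"
    then have "par w = par w' \<or> par w = dart_flip (par w')" by (intro same_edge_dart) simp
    moreover have "par w \<noteq> dart_flip (par w')"
      using flip_not_in_T[of "par w'"] w unfolding T_def by (metis imageI)
    ultimately show "w = w'" using w par by metis
  qed
  then have "card (fst ` T) = card W - 1"
    using card_image[of "fst \<circ> par" "W - {u}"] \<open>u \<in> W\<close> finW by (simp add: T_def image_comp)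
  moreover have "fst ` T \<subseteq> ball_edges u r" unfolding T_def using par by blast
  moreover have finE: "finite (ball_edges u r)" using finite_edges by (simp add: ball_edges_def)
  moreover have "card (ball_edges u r) \<le> card W" using exc by (simp add: exc_neighborhood W_def)
  \<comment> \<open>The ball has at most \<open>card W\<close> edges, and the tree uses
    \<open>card W - 1\<close> of them.\<close>
  ultimately have "card (ball_edges u r - fst ` T) \<le> 1"
    by (subst card_Diff_subset) (auto simp: T_def finW)
  then have "\<forall>x\<in>ball_edges u r - fst ` T. \<forall>y\<in>ball_edges u r - fst ` T. x = y"
    using finE card_le_Suc0_iff_eq[of "ball_edges u r - fst ` T"] by simp
  then have "\<exists>e. ball_edges u r - fst ` T \<subseteq> {e}" by blast
  then obtain e where e: "ball_edges u r - fst ` T \<subseteq> {e}" ..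
  \<comment> \<open>If no edge is left over, \<open>e\<close> is arbitrary; admitting its darts only
    enlarges the set of walks counted.\<close>
  define f where "f = (e, True)"
  have darts: "d \<in> tree_darts \<union> {f, dart_flip f}" if "fst d \<in> ball_edges u r" for d
  proof (cases "fst d \<in> fst ` T")
    case True
    then obtain t where "t \<in> T" "fst d = fst t" by auto
    then show ?thesis using same_edge_dart[of d t] by (auto simp: tree_darts_def)
  next
    case False
    then have "fst d = fst f" using that e by (auto simp: f_def)
    then show ?thesis using same_edge_dart[of d f] by auto
  qed
  have "card P \<le> 3 * card W"
  proof (rule card_reduced_walks_le[of f W P r u])
    fix p assume "p \<in> P"
    then obtain b where p: "reduced p" "length p = r" "fst ` set p \<subseteq> edges G" "walk u p b"
      using P by blast
    then have "set p \<subseteq> tree_darts \<union> {f, dart_flip f}" "b \<in> W"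
      using walk_edges_in_ball[OF u, of p b r] walk_end_in_ball[OF u, of p b r] darts
      unfolding W_def by blast+
    with p show "reduced p \<and> length p = r \<and> set p \<subseteq> tree_darts \<union> {f, dart_flip f} \<and>
        (\<exists>b\<in>W. walk u p b)"
      by blast
  qed (auto simp: dart_flip_neq finW)
  also have "\<dots> \<le> 3 * card (verts G)"
    using finite_verts by (auto intro!: card_mono simp: W_def ball_verts_def)
  finally show ?thesis .
qed

section \<open>Induced subgraphs and the bound on the excess\<close>

definition induced_darts :: "'v set \<Rightarrow> ('e \<times> bool) set" where
  "induced_darts S = {d. fst d \<in> edges (induced_subgraph G S)}"

lemma finite_induced_edges: "finite (edges (induced_subgraph G S))"
  using finite_edges by (simp add: induced_subgraph_def)

lemma induced_darts_eq: "induced_darts S = edges (induced_subgraph G S) \<times> UNIV"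
  by (auto simp: induced_darts_def)

lemma finite_induced_darts: "finite (induced_darts S)"
  by (simp add: induced_darts_eq finite_induced_edges)

lemma card_induced_darts: "card (induced_darts S) = 2 * card (edges (induced_subgraph G S))"
  by (simp add: induced_darts_eq card_cartesian_product)

lemma finite_dart_graph_induced: "finite_dart_graph dart_flip (induced_darts S)"
proof
  show "dart_flip d \<in> induced_darts S" if "d \<in> induced_darts S" for d
    using that by (simp add: induced_darts_def)
qed (rule finite_induced_darts)

text \<open>Take \<open>S\<close> of least size whose excess is at least that of \<open>G\<close>. A
  vertex with at most one dart lies on at most one edge, so removing it would not lower the excess,
  against minimality.\<close>

lemma exists_min_degree_2_subgraph:
  "\<exists>S\<subseteq>verts G. exc G \<le> exc (induced_subgraph G S) \<and>
     (\<forall>x\<in>S. card {d \<in> induced_darts S. dtail d = x} \<ge> 2)"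
proof -
  define Q where "Q S \<longleftrightarrow> S \<subseteq> verts G \<and> exc G \<le> exc (induced_subgraph G S)" for S
  have "{e \<in> edges G. set_uprod (ends G e) \<subseteq> verts G} = edges G" using ends_subset by auto
  then have "Q (verts G)" by (simp add: Q_def exc_def induced_subgraph_def)
  then obtain S where S: "Q S" "\<And>S'. Q S' \<Longrightarrow> card S \<le> card S'"
    using ex_has_least_nat[of Q "verts G" card] by blast
  have finS: "finite S" using S finite_verts by (auto simp: Q_def intro: finite_subset)
  have "card {d \<in> induced_darts S. dtail d = x} \<ge> 2" if x: "x \<in> S" for x
  proof (rule ccontr)
    let ?X = "{d \<in> induced_darts S. dtail d = x}"
    assume "\<not> card ?X \<ge> 2"
    then have X: "card (fst ` ?X) \<le> 1"
      using card_image_le[of ?X fst] finite_induced_darts[of S] by fastforce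
    have "edges (induced_subgraph G S) \<subseteq> edges (induced_subgraph G (S - {x})) \<union> fst ` ?X"
    proof
      fix e assume e: "e \<in> edges (induced_subgraph G S)"
      show "e \<in> edges (induced_subgraph G (S - {x})) \<union> fst ` ?X"
      proof (cases "x \<in> set_uprod (ends G e)")
        case True
        then obtain y where "ends G e = Upair x y" by (cases "ends G e") auto
        then obtain d where "fst d = e" "dtail d = x" using obtain_dart by metis
        then have "d \<in> ?X" using e by (simp add: induced_darts_def)
        then show ?thesis using \<open>fst d = e\<close> by blast
      qed (use e in \<open>auto simp: induced_subgraph_def\<close>)
    qed
    then have "card (edges (induced_subgraph G S))
        \<le> card (edges (induced_subgraph G (S - {x})) \<union> fst ` ?X)"
      using finite_induced_edges finite_induced_darts by (intro card_mono) auto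
    also have "\<dots> \<le> card (edges (induced_subgraph G (S - {x}))) + card (fst ` ?X)"
      by (rule card_Un_le)
    finally have "card (edges (induced_subgraph G S)) \<le> card (edges (induced_subgraph G (S - {x}))) + 1"
      using X by simp
    moreover have "card S = card (S - {x}) + 1" using x finS by (metis card.remove Suc_eq_plus1)
    ultimately have "exc (induced_subgraph G S) \<le> exc (induced_subgraph G (S - {x}))"
      by (simp add: exc_def induced_subgraph_def)
    then have "Q (S - {x})" using S(1) by (auto simp: Q_def)
    then show False using S(2)[of "S - {x}"] \<open>card S = card (S - {x}) + 1\<close> by simp
  qed
  then show ?thesis using S(1) by (auto simp: Q_def)
qed

lemma excess_bound:
  assumes r: "r \<ge> 1" and "exc G > 0" and balls: "\<And>u. u \<in> verts G \<Longrightarrow> exc (neighborhood G r u) \<le> 0"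
  shows "2 * (real r - 1) * exc G \<le> (card (verts G) + exc G) * ln (3 * card (verts G))"
proof -
  obtain S where S: "S \<subseteq> verts G" "exc G \<le> exc (induced_subgraph G S)"
      "\<And>x. x \<in> S \<Longrightarrow> card {d \<in> induced_darts S. dtail d = x} \<ge> 2"
    using exists_min_degree_2_subgraph by metis
  interpret finite_dart_graph dtail dart_flip "induced_darts S"
    by (rule finite_dart_graph_induced)
  define L where "L = ln (3 * real (card (verts G)))"
  define x where "x = real_of_int (exc (induced_subgraph G S))"
  define n where "n = real (card S)"
  have finS: "finite S" and n_le: "n \<le> card (verts G)"
    using S(1) finite_verts by (auto simp: n_def intro: finite_subset card_mono)
  have v: "card (verts G) \<ge> 1"
    using verts_nonempty[OF \<open>exc G > 0\<close>] finite_verts by (simp add: Suc_leI card_gt_0_iff)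
  then have L: "L \<ge> 0" by (simp add: L_def)
  have D: "fst d \<in> edges G \<and> dtail d \<in> S" if "d \<in> induced_darts S" for d
    using that set_ends_dart[of d] by (auto simp: induced_darts_def induced_subgraph_def)
  have deg: "deg y \<ge> 2" if "y \<in> S" for y using S(3)[OF that] by (simp add: deg_def)
  have deg_tail: "deg (dtail d) \<ge> 2" if "d \<in> induced_darts S" for d
    using D[OF that] by (simp add: deg)
  have cardD: "real (card (induced_darts S)) = 2 * (n + x)"
    by (simp add: card_induced_darts x_def n_def exc_def induced_subgraph_def)
  have "dtail ` induced_darts S \<subseteq> S" using D by blast
  then have "(real r - 1) * (4 * x) \<le> (real r - 1) * (\<Sum>d\<in>induced_darts S. ln (card (succs d)))"
    using sum_ln_card_succs_ge[OF deg_tail finS _ deg] r cardD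
    by (intro mult_left_mono) (auto simp: n_def)
  also have "\<dots> \<le> (\<Sum>d\<in>induced_darts S. ln (card (reduced_walks (r - 1) d)))"
    using sum_ln_card_reduced_walks_ge[OF deg_tail, of "r - 1"] r by (simp add: of_nat_diff)
  \<comment> \<open>\<open>d\<close> and the \<open>r - 1\<close> darts after it form a walk of
    length \<open>r\<close> from \<open>dtail d\<close>, which stays in the ball of radius
    \<open>r\<close> around that vertex in \<open>G\<close>.\<close>
  also have "\<dots> \<le> (\<Sum>d\<in>induced_darts S. L)"
  proof (rule sum_mono)
    fix d assume d: "d \<in> induced_darts S"
    have "card (reduced_walks (r - 1) d) \<le> 3 * card (verts G)"
    proof (rule card_ball_reduced_walks_le)
      show "dtail d \<in> verts G" using D[OF d] S(1) by blast
      then show "exc (neighborhood G r (dtail d)) \<le> 0" by (rule balls)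
      fix p assume "p \<in> reduced_walks (r - 1) d"
      from reduced_walks_props[OF d this] D r
      show "reduced p \<and> length p = r \<and> fst ` set p \<subseteq> edges G \<and> (\<exists>b. walk (dtail d) p b)"
        by auto
    qed
    then have "real (card (reduced_walks (r - 1) d)) \<le> real (3 * card (verts G))"
      by (rule of_nat_mono)
    moreover have "card (reduced_walks (r - 1) d) > 0"
      using reduced_walks_nonempty[OF deg_tail d] finite_reduced_walks by (simp add: card_gt_0_iff)
    ultimately show "ln (card (reduced_walks (r - 1) d)) \<le> L" by (simp add: L_def)
  qed
  also have "\<dots> = 2 * (n + x) * L" using cardD by simp
  finally have x: "(2 * (real r - 1) - L) * x \<le> n * L" by (simp add: algebra_simps)
  \<comment> \<open>Passes from \<open>S\<close> back to \<open>G\<close>, whose excess is at most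
    \<open>x\<close> and whose order is at least \<open>n\<close>. If the factor is negative, the
    left side is at most 0 and the right side is not negative.\<close>
  have "(2 * (real r - 1) - L) * exc G \<le> card (verts G) * L"
  proof (cases "2 * (real r - 1) - L \<ge> 0")
    case True
    then have "(2 * (real r - 1) - L) * exc G \<le> (2 * (real r - 1) - L) * x"
      using S(2) by (intro mult_left_mono) (auto simp: x_def)
    also have "\<dots> \<le> card (verts G) * L" using x n_le L by (meson mult_right_mono order_trans)
    finally show ?thesis .
  next
    case False
    then have "(2 * (real r - 1) - L) * exc G \<le> 0"
      using \<open>exc G > 0\<close> by (intro mult_nonpos_nonneg) auto
    also have "0 \<le> card (verts G) * L" using L by simp
    finally show ?thesis .
  qed
  then show ?thesis by (simp add: L_def algebra_simps)
qed

end


section \<open>The numerical estimate\<close>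

theorem theorem2p13:
  fixes H :: "('v, 'e) multigraph" and v r :: nat
  assumes "finite_multigraph H"
    and "card (verts H) = v"
    and "bicycle_free_at_radius r H"
    and "real r \<ge> 10 * ln (real v)"
  shows "real_of_int (exc H) \<le> ln (exp 1 * real v) / real r * real v"
proof (cases "exc H \<le> 0")
  case True
  \<comment> \<open>At \<open>v = 0\<close> the last factor vanishes; at \<open>r = 0\<close> the
    quotient is 0 by convention.\<close>
  have "0 \<le> ln (exp 1 * real v) / real r * real v"
    by (cases "v = 0") (auto simp: ln_mult)
  with True show ?thesis by linarith
next
  case False
  interpret finite_multigraph_darts H using assms(1) by unfold_locales
  have balls: "exc (neighborhood H r u) \<le> 0" if "u \<in> verts H" for u
    using assms(3) that by (auto simp: bicycle_free_at_radius_def bicycle_free_def)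
  have "v \<noteq> 0" using verts_nonempty False assms(2) finite_verts by auto
  \<comment> \<open>For \<open>v = 1\<close> the hypothesis on \<open>r\<close> allows even radius
    0, but then every ball is all of \<open>H\<close>.\<close>
  moreover have "v \<noteq> 1"
  proof
    assume "v = 1"
    then obtain u where u: "verts H = {u}" using assms(2) by (auto simp: card_1_singleton_iff)
    then have "ball_verts u r = verts H"
      using walk_end_in_ball[of u "[]" u r] by (auto simp: ball_verts_def)
    then have "exc (neighborhood H r u) = exc H"
      using ends_subset unfolding exc_neighborhood
      by (auto simp: exc_def ball_edges_def intro!: arg_cong[where f = card])
    then show False using balls[of u] u False by simp
  qed
  ultimately have v: "v \<ge> 2" by simp
  define l where "l = ln (real v)"
  define x where "x = real_of_int (exc H)"
  have "ln 2 \<le> l" using v by (simp add: l_def)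
  \<comment> \<open>\<open>ln_pred_ge\<close> at 3 says \<open>ln 2 >= 2 / 3\<close>; hence
    \<open>r >= 20 / 3\<close>, and \<open>r >= 7\<close> as \<open>r\<close> is an integer.\<close>
  then have l: "l \<ge> 2 / 3" using ln_pred_ge[of 3] by simp
  then have r: "real r > 6" "10 * l \<le> real r" using assms(4) by (auto simp: l_def)
  then have "r \<ge> 7" by simp
  \<comment> \<open>The exponential series up to the quadratic term gives
    \<open>exp (7 / 5) >= 3.38\<close>.\<close>
  have "ln 3 \<le> ln (exp (7 / 5 :: real))"
    using exp_lower_Taylor_quadratic[of "7 / 5"] by (subst ln_le_cancel_iff) (auto simp: power2_eq_square)
  then have ln3: "ln (3 * real v) \<le> l + 7 / 5" using v by (simp add: ln_mult l_def)
  have x: "x > 0" using False by (simp add: x_def)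
  have "2 * (real r - 1) * x \<le> (v + x) * ln (3 * real v)"
    using excess_bound[of r] False balls \<open>r \<ge> 7\<close> assms(2) by (simp add: x_def)
  also have "\<dots> \<le> (v + x) * (l + 7 / 5)" using x ln3 by (intro mult_left_mono) auto
  finally have "(2 * real r - 17 / 5 - l) * x \<le> v * (l + 7 / 5)" by (simp add: field_simps)
  \<comment> \<open>Since \<open>l <= r / 10\<close>, it suffices that
    \<open>r / 2 >= 17 / 5\<close>, which holds for \<open>r >= 7\<close>.\<close>
  moreover have "7 / 5 * real r * x \<le> (2 * real r - 17 / 5 - l) * x"
    using x r \<open>r \<ge> 7\<close> by (intro mult_right_mono) auto
  \<comment> \<open>Enlarging the coefficient of \<open>l\<close> to \<open>7 / 5\<close> yields a
    common factor that cancels against the left side.\<close>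
  moreover have "v * (l + 7 / 5) \<le> v * (7 / 5 * (1 + l))" using l by (intro mult_left_mono) auto
  ultimately have "7 / 5 * real r * x \<le> v * (7 / 5 * (1 + l))" by linarith
  then have "7 / 5 * (real r * x) \<le> 7 / 5 * (v * (1 + l))" by (simp only: mult_ac)
  then have "real r * x \<le> v * (1 + l)" by (simp add: mult.commute)
  moreover have "ln (exp 1 * real v) = 1 + l" using v by (simp add: l_def ln_mult)
  ultimately show ?thesis using r by (simp add: x_def field_simps)
qed

end
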